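(* Let $R$ be a weakly bleached local ring, and let $A(x)\in M_2(R[[x]])$. Then the following are equivalent: (1) $A(x)$ is very clean in $M_2(R[[x]])$. (2) $A(0)$ is very clean in $M_2(R)$.
   Context: Rings are associative with identity, not necessarily commutative. $J(R)$ denotes the Jacobson radical and $U(S)$ the group of units of a ring $S$. A ring is local if it has exactly one maximal right ideal. For $a\in R$, let $\ell_a, r_a:R\to R$ be the additive maps $\ell_a(s)=as$ and $r_a(s)=sa$, so that $(\ell_a-r_b)(s)=as-sb$. A local ring $R$ is weakly bleached if for all $a\in 1+J(R)$ and $b\in J(R)$, the maps $\ell_a-r_b$ and $\ell_b-r_a$ from $R$ to $R$ are both surjective. $R[[x]]$ is the ring of formal power series over $R$ in a central indeterminate $x$; $M_2(S)$ is the ring of $2\times2$ matrices over $S$; $A(0)$ is the matrix of constant terms of the entries of $A(x)$. An element $a$ of a ring $S$ is very clean if there exists an idempotent $e\in S$ such that $ae=ea$ and either $a-e\in U(S)$ or $a+e\in U(S)$. *)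

theory Defs
  imports
    "HOL-Computational_Algebra.Formal_Power_Series"
    "Jordan_Normal_Form.Matrix"
begin

text \<open>The coefficient ring is the type \<open>'a :: ring_1\<close>, which is not assumed commutative; the class
  axiom \<^prop>\<open>0 \<noteq> 1\<close> excludes only the zero ring, which is not local.\<close>

definition right_ideal :: "'a::ring_1 set \<Rightarrow> bool" where
  "right_ideal I \<longleftrightarrow>
     0 \<in> I \<and> (\<forall>x\<in>I. \<forall>y\<in>I. x - y \<in> I) \<and> (\<forall>x\<in>I. \<forall>r. x * r \<in> I)"

definition maximal_right_ideal :: "'a::ring_1 set \<Rightarrow> bool" where
  "maximal_right_ideal M \<longleftrightarrow>
     right_ideal M \<and> M \<noteq> UNIV \<and> (\<forall>I. right_ideal I \<and> M \<subseteq> I \<longrightarrow> I = M \<or> I = UNIV)"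

definition jacobson_radical :: "'a::ring_1 set" where
  "jacobson_radical = \<Inter> {M. maximal_right_ideal M}"

definition local_ring :: "'a::ring_1 itself \<Rightarrow> bool" where
  "local_ring _ \<longleftrightarrow> (\<exists>!M :: 'a set. maximal_right_ideal M)"

definition weakly_bleached :: "'a::ring_1 itself \<Rightarrow> bool" where
  "weakly_bleached _ \<longleftrightarrow>
     (\<forall>a \<in> (+) (1::'a) ` jacobson_radical. \<forall>b \<in> (jacobson_radical :: 'a set).
        surj (\<lambda>s. a * s - s * b) \<and> surj (\<lambda>s. b * s - s * a))"

definition very_clean :: "('a, 'b) ring_scheme \<Rightarrow> 'a \<Rightarrow> bool" where
  "very_clean S a \<longleftrightarrow>
     (\<exists>e \<in> carrier S. e \<otimes>\<^bsub>S\<^esub> e = e \<and> a \<otimes>\<^bsub>S\<^esub> e = e \<otimes>\<^bsub>S\<^esub> a \<and>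
        (a \<ominus>\<^bsub>S\<^esub> e \<in> Units S \<or> a \<oplus>\<^bsub>S\<^esub> e \<in> Units S))"

abbreviation M2 :: "'a::ring_1 itself \<Rightarrow> 'a mat ring" where
  "M2 ty \<equiv> ring_mat ty 2 ()"

text \<open>The library proves that \<^const>\<open>ring_mat\<close> is a ring only over commutative coefficients.\<close>

lemma ring_ring_mat: "ring (ring_mat TYPE('a::ring_1) n b)"
  by (unfold_locales, insert add_inv_exists_mat, auto simp: ring_mat_def algebra_simps Units_def)

lemma minus_ring_mat:
  assumes "A \<in> carrier_mat n n" and "E \<in> carrier_mat n n"
  shows "A \<ominus>\<^bsub>ring_mat TYPE('a::ring_1) n b\<^esub> E = A - E"
proof -
  interpret ring "ring_mat TYPE('a) n b" by (rule ring_ring_mat)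
  have "\<ominus>\<^bsub>ring_mat TYPE('a) n b\<^esub> E = - E"
    using assms by (intro minus_equality) (auto simp: ring_mat_simps)
  then show ?thesis
    using assms by (simp add: a_minus_def ring_mat_simps add_uminus_minus_mat)
qed

end

theory Submission
  imports Defs
begin

text \<open>Taking constant terms is a ring homomorphism, so it carries a witness of very cleanness over
  \<open>R[[x]]\<close> to one over \<open>R\<close>. For the converse, let \<open>A\<^sub>0\<close> be the constant term of \<open>A\<close> and let \<open>E\<close> be an
  idempotent witnessing that \<open>A\<^sub>0\<close> is very clean. Units lift along constant terms, so if \<open>A\<^sub>0\<close>,
  \<open>A\<^sub>0 - 1\<close> or \<open>A\<^sub>0 + 1\<close> is a unit, then the idempotent \<open>0\<close> or \<open>1\<close> serves for \<open>A\<close>. In the remaining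
  case \<open>E\<close> is nontrivial.

  Over a local ring a nontrivial idempotent of \<open>M\<^sub>2(R)\<close> is similar to \<open>diag(1,0)\<close> or \<open>diag(0,1)\<close>, and a
  matrix commuting with it becomes diagonal in the same basis
  (\<open>commuting_idempotent_diagonalises\<close>). So \<open>A\<^sub>0\<close> is similar to some \<open>diag(a,b)\<close>. As neither \<open>A\<^sub>0\<close> nor
  \<open>A\<^sub>0 - 1\<close> is a unit, one of \<open>a, b\<close> lies in \<open>J(R)\<close> and the other in \<open>1 + J(R)\<close>; this is exactly
  where weak bleachedness makes both \<open>s \<mapsto> as - sb\<close> and \<open>s \<mapsto> bs - sa\<close> surjective.

  After conjugating by a constant matrix, \<open>A\<close> has constant term \<open>diag(a,b)\<close>. An eigenvector basis
  of the form \<open>(1,t), (s,1)\<close> amounts to two noncommutative Riccati equations for \<open>s\<close> and \<open>t\<close>, and the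
  surjectivity solves them coefficient by coefficient (\<open>fps_riccati_solution\<close>). Hence \<open>A\<close> is similar
  to a diagonal matrix over \<open>R[[x]]\<close>, and such a matrix is very clean, because every \<open>f\<close> in \<open>R[[x]]\<close>
  has \<open>f\<close> or \<open>f - 1\<close> invertible.

  The argument runs in a type of two by two matrices that is itself an instance of
  \<^class>\<open>ring_1\<close>; the last part transports the result to \<^const>\<open>ring_mat\<close>.\<close>

no_notation vec_index (infixl "$" 100)
unbundle fps_syntax

section \<open>Units and very clean elements\<close>

definition two_sided_unit :: "'a::ring_1 \<Rightarrow> bool" where
  "two_sided_unit x \<longleftrightarrow> (\<exists>y. x * y = 1 \<and> y * x = 1)"

definition very_clean_elt :: "'a::ring_1 \<Rightarrow> bool" where
  "very_clean_elt a \<longleftrightarrow>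
     (\<exists>e. e * e = e \<and> a * e = e * a \<and> (two_sided_unit (a - e) \<or> two_sided_unit (a + e)))"

lemma two_sided_unitI: "x * y = 1 \<Longrightarrow> y * x = 1 \<Longrightarrow> two_sided_unit x"
  unfolding two_sided_unit_def by blast

lemma two_sided_unitE:
  assumes "two_sided_unit x"
  obtains y where "x * y = 1" "y * x = 1"
  using assms unfolding two_sided_unit_def by blast

lemma two_sided_unit_1 [simp]: "two_sided_unit 1"
  by (rule two_sided_unitI[of _ 1]) simp_all

lemma two_sided_unit_left_right_inverse:
  assumes "x * y = 1" "z * x = 1"
  shows "two_sided_unit x"
proof -
  have "z = z * (x * y)" using assms by simp
  also have "\<dots> = (z * x) * y" by (simp only: mult.assoc)
  also have "\<dots> = y" using assms by simp
  finally show ?thesis using assms two_sided_unitI by blast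
qed

lemma two_sided_unit_mult:
  assumes "two_sided_unit x" "two_sided_unit y"
  shows "two_sided_unit (x * y)"
proof -
  obtain x' where x': "x * x' = 1" "x' * x = 1" using assms(1) by (rule two_sided_unitE)
  obtain y' where y': "y * y' = 1" "y' * y = 1" using assms(2) by (rule two_sided_unitE)
  have "(x * y) * (y' * x') = x * (y * y') * x'" "(y' * x') * (x * y) = y' * (x' * x) * y"
    by (simp_all only: mult.assoc)
  with x' y' show ?thesis by (intro two_sided_unitI[of _ "y' * x'"]) simp_all
qed

lemma two_sided_unit_minus_iff: "two_sided_unit (- x) \<longleftrightarrow> two_sided_unit (x::'a::ring_1)"
proof -
  have "two_sided_unit (- x)" if "two_sided_unit x" for x :: 'a
    using that by (metis minus_mult_minus two_sided_unit_def)
  from this[of x] this[of "- x"] show ?thesis by auto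
qed

lemma two_sided_unit_diff_commute: "two_sided_unit (x - y) \<longleftrightarrow> two_sided_unit (y - x)"
  using two_sided_unit_minus_iff[of "x - y"] by simp

lemma idempotent_unit_eq_1:
  assumes "e * e = e" "two_sided_unit e"
  shows "e = 1"
proof -
  obtain y where "y * e = 1" using assms(2) by (rule two_sided_unitE)
  have "e = (y * e) * e" using \<open>y * e = 1\<close> by simp
  also have "\<dots> = y * (e * e)" by (simp only: mult.assoc)
  finally show ?thesis using assms(1) \<open>y * e = 1\<close> by simp
qed

text \<open>Similarity is written \<open>x * p = p * y\<close> with \<open>p\<close> a unit: such relations can be added,
  multiplied and checked entrywise without naming the inverse of \<open>p\<close>.\<close>

lemma two_sided_unit_similar:
  assumes "two_sided_unit p" "x * p = p * y" "two_sided_unit y"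
  shows "two_sided_unit x"
proof -
  obtain q where q: "p * q = 1" "q * p = 1" using assms(1) by (rule two_sided_unitE)
  have "x = (x * p) * q" using q by (simp add: mult.assoc)
  then have "x = p * y * q" using assms(2) by simp
  moreover have "two_sided_unit q" using q two_sided_unitI by blast
  ultimately show ?thesis using assms two_sided_unit_mult by blast
qed

lemma very_clean_elt_similar:
  assumes "two_sided_unit p" "x * p = p * y" "very_clean_elt y"
  shows "very_clean_elt x"
proof -
  obtain q where q: "p * q = 1" "q * p = 1" using assms(1) by (rule two_sided_unitE)
  obtain e where e: "e * e = e" "y * e = e * y" "two_sided_unit (y - e) \<or> two_sided_unit (y + e)"
    using assms(3) unfolding very_clean_elt_def by blast
  define f where "f = p * e * q"
  have fp: "f * p = p * e" unfolding f_def using q by (simp add: mult.assoc)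
  \<comment> \<open>Identities between conjugates may be checked after multiplying by \<open>p\<close> on the right.\<close>
  have cancel: "u = v" if "u * p = v * p" for u v
  proof -
    have "u = (u * p) * q" "v = (v * p) * q" using q by (simp_all add: mult.assoc)
    with that show ?thesis by simp
  qed
  have "f * f = f"
    by (rule cancel) (metis e(1) fp mult.assoc)
  moreover have "x * f = f * x"
    by (rule cancel) (metis assms(2) e(2) fp mult.assoc)
  moreover have "(x - f) * p = p * (y - e)" "(x + f) * p = p * (y + e)"
    using fp assms(2) by (simp_all add: algebra_simps)
  then have "two_sided_unit (x - f) \<or> two_sided_unit (x + f)"
    using e(3) assms(1) two_sided_unit_similar by blast
  ultimately show ?thesis unfolding very_clean_elt_def by blast
qed

lemma very_clean_elt_if_unit: "two_sided_unit x \<Longrightarrow> very_clean_elt x"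
  unfolding very_clean_elt_def by (intro exI[of _ 0]) simp

lemma very_clean_elt_if_unit_minus_1: "two_sided_unit (x - 1) \<Longrightarrow> very_clean_elt x"
  unfolding very_clean_elt_def by (intro exI[of _ 1]) simp

lemma very_clean_elt_if_unit_plus_1: "two_sided_unit (x + 1) \<Longrightarrow> very_clean_elt x"
  unfolding very_clean_elt_def by (intro exI[of _ 1]) simp

section \<open>Local rings\<close>

lemma right_ideal_principal: "right_ideal (range ((*) (x::'a::ring_1)))"
  unfolding right_ideal_def
proof (intro conjI ballI allI)
  show "0 \<in> range ((*) x)" by (rule range_eqI[of _ _ 0]) simp
  show "u - v \<in> range ((*) x)" if "u \<in> range ((*) x)" "v \<in> range ((*) x)" for u v
    using that by (auto simp flip: right_diff_distrib)
  show "u * r \<in> range ((*) x)" if "u \<in> range ((*) x)" for u r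
    using that by (auto simp: mult.assoc)
qed

text \<open>Zorn's lemma applies because properness of a right ideal is the condition that it misses
  \<open>1\<close>, and this is preserved by unions of chains.\<close>

lemma proper_right_ideal_subset_maximal:
  assumes I: "right_ideal (I :: 'a::ring_1 set)" "1 \<notin> I"
  obtains M where "maximal_right_ideal M" "I \<subseteq> M"
proof -
  define S where "S = {K. right_ideal K \<and> (1::'a) \<notin> K \<and> I \<subseteq> K}"
  have UNIV_if: "K = UNIV" if "right_ideal K" "1 \<in> K" for K :: "'a set"
  proof -
    have "1 * x \<in> K" for x using that unfolding right_ideal_def by blast
    then show ?thesis by auto
  qed
  have "\<exists>M\<in>S. \<forall>X\<in>S. M \<subseteq> X \<longrightarrow> X = M"
  proof (rule subset_Zorn_nonempty)
    show "S \<noteq> {}" using I unfolding S_def by blast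
    fix C assume ne: "C \<noteq> {}" and ch: "subset.chain S C"
    have sub: "C \<subseteq> S" and tot: "\<And>X Y. X \<in> C \<Longrightarrow> Y \<in> C \<Longrightarrow> X \<subseteq> Y \<or> Y \<subseteq> X"
      using ch unfolding subset_chain_def by blast+
    have ri: "right_ideal X" if "X \<in> C" for X
      using that sub unfolding S_def by blast
    have "right_ideal (\<Union>C)"
      unfolding right_ideal_def
    proof (intro conjI ballI allI)
      show "0 \<in> \<Union>C" using ne ri unfolding right_ideal_def by auto
      show "u * r \<in> \<Union>C" if "u \<in> \<Union>C" for u r
      proof -
        from that obtain X where X: "X \<in> C" "u \<in> X" ..
        with ri[of X] have "u * r \<in> X" unfolding right_ideal_def by blast
        with X show ?thesis by blast
      qed
      show "u - v \<in> \<Union>C" if "u \<in> \<Union>C" "v \<in> \<Union>C" for u v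
      proof -
        from \<open>u \<in> \<Union>C\<close> obtain X where "X \<in> C" "u \<in> X" ..
        moreover from \<open>v \<in> \<Union>C\<close> obtain Y where "Y \<in> C" "v \<in> Y" ..
        ultimately obtain Z where "Z \<in> C" "u \<in> Z" "v \<in> Z" using tot[of X Y] by blast
        then show ?thesis using ri[of Z] unfolding right_ideal_def by blast
      qed
    qed
    then show "\<Union>C \<in> S" using ne sub unfolding S_def by blast
  qed
  then obtain M where M: "M \<in> S" "\<And>X. X \<in> S \<Longrightarrow> M \<subseteq> X \<Longrightarrow> X = M" by blast
  have "K = M \<or> K = UNIV" if "right_ideal K" "M \<subseteq> K" for K
    using that M UNIV_if[of K] unfolding S_def by blast
  then have "maximal_right_ideal M"
    using M(1) unfolding maximal_right_ideal_def S_def by blast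
  then show ?thesis using that M(1) unfolding S_def by blast
qed

lemma local_ring_jacobson_radical:
  assumes "local_ring TYPE('a::ring_1)"
  shows "maximal_right_ideal (jacobson_radical :: 'a set)"
    and "maximal_right_ideal (M :: 'a set) \<Longrightarrow> M = jacobson_radical"
proof -
  obtain N :: "'a set" where N: "maximal_right_ideal N" "\<And>M. maximal_right_ideal M \<Longrightarrow> M = N"
    using assms unfolding local_ring_def by blast
  then have "{M. maximal_right_ideal M} = {N}" by blast
  then have "jacobson_radical = N" unfolding jacobson_radical_def by simp
  with N show "maximal_right_ideal (jacobson_radical :: 'a set)"
    and "maximal_right_ideal M \<Longrightarrow> M = jacobson_radical" by blast+
qed

text \<open>An element outside the unique maximal right ideal \<open>J\<close> generates the whole ring as a right ideal,
  hence has a right inverse \<open>y\<close>. To see that \<open>y\<close> is two-sided it suffices that \<open>y\<close> lies outside \<open>J\<close>,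
  too, for then \<open>y\<close> also has a right inverse, which must be \<open>x\<close>. If \<open>y\<close> were in \<open>J\<close>, then \<open>1 - y * x\<close>
  would have a right inverse; but \<open>x * (1 - y * x) = 0\<close>, which forces
  \<open>x = 0\<close>.\<close>

lemma local_ring_unit_iff:
  assumes loc: "local_ring TYPE('a::ring_1)"
  shows "two_sided_unit (x::'a) \<longleftrightarrow> x \<notin> jacobson_radical"
proof -
  let ?J = "jacobson_radical :: 'a set"
  have max: "maximal_right_ideal ?J" by (rule local_ring_jacobson_radical(1)[OF loc])
  have ri: "right_ideal ?J" using max unfolding maximal_right_ideal_def by blast
  have absorb: "u * r \<in> ?J" if "u \<in> ?J" for u r using ri that unfolding right_ideal_def by blast
  have one: "1 \<notin> ?J"
  proof
    assume "1 \<in> ?J"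
    then have "r \<in> ?J" for r using absorb[of 1 r] by simp
    then show False using max unfolding maximal_right_ideal_def by auto
  qed
  have diff: "u - v \<in> ?J" if "u \<in> ?J" "v \<in> ?J" for u v
    using ri that unfolding right_ideal_def by blast
  have right_inv: "\<exists>y. u * y = 1" if "u \<notin> ?J" for u
  proof (rule ccontr)
    assume "\<nexists>y. u * y = 1"
    then have "1 \<notin> range ((*) u)" by force
    then obtain M where M: "maximal_right_ideal M" "range ((*) u) \<subseteq> M"
      using proper_right_ideal_subset_maximal[OF right_ideal_principal] by blast
    have "u * 1 \<in> M" using M(2) by blast
    then have "u \<in> M" by simp
    then show False using that local_ring_jacobson_radical(2)[OF loc M(1)] by blast
  qed
  show ?thesis
  proof
    assume "two_sided_unit x"
    then obtain y where "x * y = 1" by (rule two_sided_unitE)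
    then show "x \<notin> ?J" using absorb[of x y] one by auto
  next
    assume x: "x \<notin> ?J"
    then obtain y where y: "x * y = 1" using right_inv by blast
    have "y \<notin> ?J"
    proof
      assume "y \<in> ?J"
      have "1 - y * x \<notin> ?J"
      proof
        assume "1 - y * x \<in> ?J"
        moreover have "0 - y * x \<in> ?J" using ri absorb[OF \<open>y \<in> ?J\<close>] diff
          unfolding right_ideal_def by blast
        ultimately have "(1 - y * x) - (0 - y * x) \<in> ?J" by (rule diff)
        then show False using one by simp
      qed
      then obtain z where z: "(1 - y * x) * z = 1" using right_inv by blast
      have "x = x * ((1 - y * x) * z)" using z by simp
      also have "\<dots> = (x - (x * y) * x) * z" by (simp add: algebra_simps)
      also have "\<dots> = 0" using y by simp
      finally have "x = 0" .
      then show False using x ri unfolding right_ideal_def by blast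
    qed
    then obtain z where z: "y * z = 1" using right_inv by blast
    have "x = x * (y * z)" using z by simp
    also have "\<dots> = z" using y by (simp flip: mult.assoc)
    finally show "two_sided_unit x" using y z two_sided_unitI by blast
  qed
qed

text \<open>Non-units form an additive group, and \<open>1\<close> is not in it.\<close>

lemma local_ring_unit_or:
  assumes loc: "local_ring TYPE('a::ring_1)"
  shows "two_sided_unit (x::'a) \<or> two_sided_unit (x - 1)"
proof (rule ccontr)
  assume "\<not> ?thesis"
  then have "x \<in> jacobson_radical" "x - 1 \<in> jacobson_radical"
    using local_ring_unit_iff[OF loc] by blast+
  moreover have "right_ideal (jacobson_radical :: 'a set)"
    using local_ring_jacobson_radical(1)[OF loc] unfolding maximal_right_ideal_def by blast
  ultimately have "x - (x - 1) \<in> jacobson_radical" unfolding right_ideal_def by blast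
  then show False using local_ring_unit_iff[OF loc, of 1] by simp
qed

lemma local_ring_idempotent:
  assumes loc: "local_ring TYPE('a::ring_1)" and e: "(e::'a) * e = e"
  shows "e = 0 \<or> e = 1"
proof -
  have "two_sided_unit e \<or> two_sided_unit (1 - e)"
    using local_ring_unit_or[OF loc, of e] two_sided_unit_diff_commute[of e 1] by blast
  moreover have "(1 - e) * (1 - e) = 1 - e" using e by (simp add: algebra_simps)
  ultimately show ?thesis using idempotent_unit_eq_1[of e] idempotent_unit_eq_1[of "1 - e"] e by auto
qed

section \<open>The ring of two by two matrices\<close>

datatype 'a mat2 = Mat2 'a 'a 'a 'a

instantiation mat2 :: (ring_1) ring_1
begin

definition "0 = Mat2 0 0 0 0"
definition "1 = Mat2 1 0 0 1"

fun plus_mat2 :: "'a mat2 \<Rightarrow> 'a mat2 \<Rightarrow> 'a mat2" where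
  "Mat2 a b c d + Mat2 a' b' c' d' = Mat2 (a + a') (b + b') (c + c') (d + d')"

fun minus_mat2 :: "'a mat2 \<Rightarrow> 'a mat2 \<Rightarrow> 'a mat2" where
  "Mat2 a b c d - Mat2 a' b' c' d' = Mat2 (a - a') (b - b') (c - c') (d - d')"

fun uminus_mat2 :: "'a mat2 \<Rightarrow> 'a mat2" where
  "- Mat2 a b c d = Mat2 (- a) (- b) (- c) (- d)"

fun times_mat2 :: "'a mat2 \<Rightarrow> 'a mat2 \<Rightarrow> 'a mat2" where
  "Mat2 a b c d * Mat2 a' b' c' d' =
     Mat2 (a * a' + b * c') (a * b' + b * d') (c * a' + d * c') (c * b' + d * d')"

instance
proof
  fix x y z :: "'a mat2"
  show "x * y * z = x * (y * z)" "x + y + z = x + (y + z)" "x + y = y + x"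
    "0 + x = x" "- x + x = 0" "x - y = x + - y" "1 * x = x" "x * 1 = x"
    "(x + y) * z = x * z + y * z" "x * (y + z) = x * y + x * z"
    by (cases x; cases y; cases z; simp add: zero_mat2_def one_mat2_def algebra_simps)+
  show "(0 :: 'a mat2) \<noteq> 1" by (simp add: zero_mat2_def one_mat2_def)
qed

end

lemma map_mat2_ring_hom:
  assumes "\<And>x y. f (x + y) = f x + f y" "\<And>x y. f (x * y) = f x * f y" "f 1 = 1"
    "\<And>x y. f (x - y) = f x - f y"
  shows "map_mat2 f (A * B) = map_mat2 f A * map_mat2 f B"
    and "map_mat2 f (A + B) = map_mat2 f A + map_mat2 f B"
    and "map_mat2 f (A - B) = map_mat2 f A - map_mat2 f B"
    and "map_mat2 f 1 = 1"
proof -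
  have "f 0 = 0" using assms(4)[of 0 0] by simp
  then show "map_mat2 f (A * B) = map_mat2 f A * map_mat2 f B"
    "map_mat2 f (A + B) = map_mat2 f A + map_mat2 f B"
    "map_mat2 f (A - B) = map_mat2 f A - map_mat2 f B"
    "map_mat2 f 1 = 1"
    by (cases A; cases B; simp add: assms one_mat2_def)+
qed

abbreviation diag2 :: "'a::ring_1 \<Rightarrow> 'a \<Rightarrow> 'a mat2" where
  "diag2 a b \<equiv> Mat2 a 0 0 b"

lemma two_sided_unit_diag2:
  assumes "two_sided_unit a" "two_sided_unit b"
  shows "two_sided_unit (diag2 a b)"
proof -
  obtain a' b' where "a * a' = 1" "a' * a = 1" "b * b' = 1" "b' * b = 1"
    using assms by (meson two_sided_unitE)
  then show ?thesis by (intro two_sided_unitI[of _ "diag2 a' b'"]) (simp_all add: one_mat2_def)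
qed

lemma two_sided_unit_lower: "two_sided_unit (Mat2 1 0 c (1::'a::ring_1))"
  by (rule two_sided_unitI[of _ "Mat2 1 0 (- c) 1"]) (simp_all add: one_mat2_def)

lemma two_sided_unit_upper: "two_sided_unit (Mat2 1 c 0 (1::'a::ring_1))"
  by (rule two_sided_unitI[of _ "Mat2 1 (- c) 0 1"]) (simp_all add: one_mat2_def)

text \<open>The matrix is a product of a lower triangular, a diagonal and an upper triangular one, with the
  Schur complement \<open>d - c * a' * b\<close> in the diagonal factor.\<close>

lemma two_sided_unit_mat2_schur:
  assumes "a * a' = 1" "a' * a = 1" "two_sided_unit (d - c * a' * b)"
  shows "two_sided_unit (Mat2 a b c d)"
proof -
  have "Mat2 a b c d = Mat2 1 0 (c * a') 1 * diag2 a (d - c * a' * b) * Mat2 1 (a' * b) 0 1"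
    using assms(1,2) by (simp add: mult.assoc) (simp flip: mult.assoc)
  moreover have "two_sided_unit a" using assms(1,2) by (rule two_sided_unitI)
  ultimately show ?thesis
    using assms(3) by (simp only: two_sided_unit_mult two_sided_unit_lower two_sided_unit_upper
        two_sided_unit_diag2)
qed

section \<open>Diagonalisation over a local ring\<close>

text \<open>As \<open>u\<close> is a unit, the first column of \<open>E\<close> can be scaled to \<open>(1,d)\<close>, which \<open>E\<close> fixes. Taking it as
  first basis vector turns \<open>E\<close> into \<open>[[1,p],[0,f]]\<close> with \<open>f\<close> idempotent and \<open>p * f = 0\<close>. Locality
  leaves \<open>f = 1\<close>, which would give \<open>E = 1\<close>, or \<open>f = 0\<close>, in which case a further shear removes \<open>p\<close>.\<close>

lemma idempotent_diagonalisable_if_unit_entry: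
  fixes E :: "'a::ring_1 mat2"
  assumes loc: "local_ring TYPE('a)"
    and E: "E = Mat2 u p c g" "E * E = E" "E \<noteq> 1" and u: "two_sided_unit u"
  shows "\<exists>P. two_sided_unit P \<and> E * P = P * diag2 1 0"
proof -
  obtain w where w: "u * w = 1" "w * u = 1" using u by (rule two_sided_unitE)
  have eqs: "u * u + p * c = u" "u * p + p * g = p" "c * u + g * c = c" "c * p + g * g = g"
    using E by simp_all
  define d where "d = c * w"
  define f where "f = g - d * p"
  have du: "d * u = c" unfolding d_def using w by (simp add: mult.assoc)
  have pd: "u + p * d = 1"
  proof -
    have "u + p * d = (u * u + p * c) * w" unfolding d_def using w by (simp add: algebra_simps)
    then show ?thesis using eqs w by simp
  qed
  have gd: "c + g * d = d"
  proof -
    have "c + g * d = (c * u + g * c) * w" unfolding d_def using w by (simp add: algebra_simps)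
    then show ?thesis using eqs by (simp add: d_def)
  qed
  have pf: "p * f = 0"
  proof -
    have "p * f = (u * p + p * g) - (u + p * d) * p" unfolding f_def by (simp add: algebra_simps)
    then show ?thesis using eqs pd by simp
  qed
  have "f * f = g * f - d * (p * f)" unfolding f_def by (simp add: algebra_simps)
  also have "\<dots> = (c * p + g * g) - (c + g * d) * p"
    unfolding pf unfolding f_def by (simp add: algebra_simps)
  also have "\<dots> = f" unfolding eqs gd f_def ..
  finally have "f = 0 \<or> f = 1" using local_ring_idempotent[OF loc] by blast
  moreover have "f \<noteq> 1"
  proof
    assume "f = 1"
    then have "p = 0" using pf by simp
    then have "g = 1" "u = 1" using \<open>f = 1\<close> pd unfolding f_def by simp_all
    moreover from this have "c = 0" using eqs(3) by simp
    ultimately show False using E \<open>p = 0\<close> by (simp add: one_mat2_def)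
  qed
  ultimately have f: "g = d * p" unfolding f_def by simp
  let ?P = "Mat2 1 0 d 1 * Mat2 1 (- p) 0 1"
  have "u * p + p * (d * p) = p" "c * p + g * (d * p) = d * p"
    using pd gd by (metis distrib_right mult.assoc mult_1)+
  then have "E * ?P = ?P * diag2 1 0"
    using pd gd f unfolding E(1) by (simp add: algebra_simps)
  moreover have "two_sided_unit ?P"
    by (intro two_sided_unit_mult two_sided_unit_lower two_sided_unit_upper)
  ultimately show ?thesis by blast
qed

lemma idempotent_diagonalisable:
  fixes E :: "'a::ring_1 mat2"
  assumes loc: "local_ring TYPE('a)" and E: "E * E = E" "E \<noteq> 0" "E \<noteq> 1"
  shows "\<exists>P. two_sided_unit P \<and> (E * P = P * diag2 1 0 \<or> E * P = P * diag2 0 1)"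
proof -
  obtain u p c g where Eeq: "E = Mat2 u p c g" by (cases E)
  show ?thesis
  proof (cases "two_sided_unit u")
    case True
    then show ?thesis using idempotent_diagonalisable_if_unit_entry[OF loc Eeq] E by blast
  next
    case False
    then have "two_sided_unit (1 - u)"
      using local_ring_unit_or[OF loc] two_sided_unit_diff_commute by blast
    moreover have "1 - E = Mat2 (1 - u) (- p) (- c) (1 - g)" by (simp add: Eeq one_mat2_def)
    moreover have "1 - E \<noteq> 1" using E by simp
    moreover have "(1 - E) * (1 - E) = 1 - E" using E by (simp add: algebra_simps)
    ultimately obtain P where P: "two_sided_unit P" "(1 - E) * P = P * diag2 1 0"
      using idempotent_diagonalisable_if_unit_entry[OF loc] by blast
    \<comment> \<open>The basis that diagonalises \<open>1 - E\<close> diagonalises \<open>E\<close>, with the two entries exchanged.\<close>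
    have "E * P = P * (1 - diag2 1 0)" using P(2) by (simp add: algebra_simps)
    also have "1 - diag2 1 0 = (diag2 0 1 :: 'a mat2)" by (simp add: one_mat2_def)
    finally show ?thesis using P(1) by blast
  qed
qed

text \<open>In a basis where \<open>E\<close> is \<open>diag(1,0)\<close> or \<open>diag(0,1)\<close>, commuting with \<open>E\<close> forces the
  off-diagonal entries to vanish.\<close>

lemma commuting_idempotent_diagonalises:
  fixes A E :: "'a::ring_1 mat2"
  assumes loc: "local_ring TYPE('a)" and E: "E * E = E" "E \<noteq> 0" "E \<noteq> 1" and AE: "A * E = E * A"
  shows "\<exists>P a b. two_sided_unit P \<and> A * P = P * diag2 a b"
proof -
  obtain P D where P: "two_sided_unit P" "E * P = P * D" and D: "D = diag2 1 0 \<or> D = diag2 0 1"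
    using idempotent_diagonalisable[OF loc E] by blast
  obtain Q where Q: "P * Q = 1" "Q * P = 1" using P(1) by (rule two_sided_unitE)
  define B where "B = Q * A * P"
  have "D = Q * (E * P)" unfolding P(2) using Q by (simp flip: mult.assoc)
  then have QE: "Q * E = D * Q" using Q by (simp add: mult.assoc)
  have "D * B = (D * Q) * A * P" unfolding B_def by (simp only: mult.assoc)
  also have "\<dots> = Q * (E * A) * P" unfolding QE[symmetric] by (simp only: mult.assoc)
  also have "\<dots> = Q * A * (E * P)" unfolding AE[symmetric] by (simp only: mult.assoc)
  also have "\<dots> = B * D" unfolding P(2) B_def by (simp only: mult.assoc)
  finally have "D * B = B * D" .
  moreover obtain a p q b where "B = Mat2 a p q b" by (cases B)
  ultimately have "B = diag2 a b" using D by auto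
  moreover have "A * P = P * B" unfolding B_def using Q by (simp flip: mult.assoc)
  ultimately show ?thesis using P(1) by blast
qed

section \<open>Power series\<close>

lemma two_sided_unit_fps:
  assumes "two_sided_unit (f $ 0)"
  shows "two_sided_unit (f :: 'a::ring_1 fps)"
proof -
  obtain y where "f $ 0 * y = 1" "y * f $ 0 = 1" using assms by (rule two_sided_unitE)
  then have "f * fps_right_inverse f y = 1" "fps_left_inverse f y * f = 1"
    by (simp_all add: fps_left_inverse fps_right_inverse)
  then show ?thesis by (rule two_sided_unit_left_right_inverse)
qed

abbreviation const_term_mat2 :: "'a::ring_1 fps mat2 \<Rightarrow> 'a mat2" where
  "const_term_mat2 \<equiv> map_mat2 (\<lambda>f. f $ 0)"

lemmas const_term_mat2_hom =
  map_mat2_ring_hom[of "\<lambda>f :: 'a::ring_1 fps. f $ 0", simplified]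

lemmas fps_const_mat2_hom =
  map_mat2_ring_hom[of "fps_const :: 'a::ring_1 \<Rightarrow> 'a fps", simplified]

lemma const_term_fps_const_mat2 [simp]: "const_term_mat2 (map_mat2 fps_const A) = A"
  by (cases A) simp

lemma two_sided_unit_if_const_term_1:
  assumes "const_term_mat2 A = 1"
  shows "two_sided_unit A"
proof -
  obtain a b c d where A: "A = Mat2 a b c d" by (cases A)
  with assms have 0: "a $ 0 = 1" "b $ 0 = 0" "c $ 0 = 0" "d $ 0 = 1"
    by (simp_all add: one_mat2_def)
  have "two_sided_unit a" using 0 by (simp add: two_sided_unit_fps)
  then obtain a' where a': "a * a' = 1" "a' * a = 1" by (rule two_sided_unitE)
  have "two_sided_unit (d - c * a' * b)" using 0 by (simp add: two_sided_unit_fps)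
  with a' show ?thesis unfolding A by (rule two_sided_unit_mat2_schur)
qed

text \<open>Multiplying by a constant matrix that inverts the constant term, on either side, reduces to
  constant term \<open>1\<close>.\<close>

lemma two_sided_unit_fps_mat2:
  assumes "two_sided_unit (const_term_mat2 A)"
  shows "two_sided_unit A"
proof -
  obtain Y where Y: "const_term_mat2 A * Y = 1" "Y * const_term_mat2 A = 1"
    using assms by (rule two_sided_unitE)
  let ?Y = "map_mat2 fps_const Y"
  have "two_sided_unit (A * ?Y)" "two_sided_unit (?Y * A)"
    using Y by (simp_all add: two_sided_unit_if_const_term_1 const_term_mat2_hom)
  then obtain U V where "A * ?Y * U = 1" "V * (?Y * A) = 1" by (metis two_sided_unitE)
  then show ?thesis
    by (intro two_sided_unit_left_right_inverse[of A "?Y * U" "V * ?Y"]) (simp_all add: mult.assoc)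
qed

text \<open>Since \<open>s $ 0 = 0\<close>, the coefficient of \<open>s * q * s\<close> at \<open>n\<close> involves only coefficients of \<open>s\<close> below \<open>n\<close>.
  The coefficient of the whole equation at \<open>n\<close> therefore prescribes the value of
  \<open>a $ 0 * y - y * b $ 0\<close> at the unknown \<open>y = s $ n\<close>, which surjectivity permits. The solution is
  the limit of a sequence of solutions modulo growing powers of \<open>x\<close>, each extending the one before.\<close>

lemma fps_riccati_solution:
  fixes a b p q :: "'a::ring_1 fps"
  assumes surj: "surj (\<lambda>s. a $ 0 * s - s * b $ 0)" and p: "p $ 0 = 0"
  shows "\<exists>s. s $ 0 = 0 \<and> a * s - s * b = p + s * q * s"
proof -
  define F where "F s = a * s - s * b - p - s * q * s" for s
  define sol where "sol n s \<longleftrightarrow> s $ 0 = 0 \<and> (\<forall>k\<le>n. F s $ k = 0)" for n :: nat and s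
  have causal: "F s $ n = F t $ n" if "\<forall>k\<le>n. s $ k = t $ k" for s t n
  proof -
    have sq: "(s * q) $ k = (t * q) $ k" if "k \<le> n" for k
      unfolding fps_mult_nth using that \<open>\<forall>k\<le>n. s $ k = t $ k\<close> by (intro sum.cong) auto
    have "(s * q * s) $ n = (t * q * t) $ n"
      unfolding fps_mult_nth[of "s * q"] fps_mult_nth[of "t * q"]
      using that sq by (intro sum.cong) auto
    moreover have "(a * s) $ n = (a * t) $ n" "(s * b) $ n = (t * b) $ n"
      unfolding fps_mult_nth using that by (auto intro: sum.cong)
    ultimately show ?thesis unfolding F_def by simp
  qed
  have step: "\<exists>t. sol (Suc n) t \<and> (\<forall>k\<le>n. t $ k = s $ k)" if s: "sol n s" for n s
  proof -
    obtain y where y: "a $ 0 * y - y * b $ 0 = - F s $ Suc n"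
      using surj[unfolded surj_def] by metis
    define d where "d = fps_const y * fps_X ^ Suc n"
    have d_nth: "d $ k = (if k = Suc n then y else 0)" for k
      unfolding d_def by (auto simp: fps_X_power_mult_right_nth simp del: power_Suc)
    have left: "(h * d) $ k = (if k = Suc n then h $ 0 * y else 0)" if "k \<le> Suc n" for h k
    proof -
      have "h * d = (h * fps_const y) * fps_X ^ Suc n" unfolding d_def by (simp only: mult.assoc)
      then show ?thesis using that by (simp add: fps_X_power_mult_right_nth del: power_Suc)
    qed
    have right: "(d * h) $ k = (if k = Suc n then y * h $ 0 else 0)" if "k \<le> Suc n" for h k
    proof -
      have "d * h = fps_X ^ Suc n * (fps_const y * h)"
        unfolding d_def by (simp only: fps_mult_fps_X_power_commute mult.assoc)
      then show ?thesis using that by (simp add: fps_X_power_mult_nth del: power_Suc)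
    qed
    \<comment> \<open>Grouped so that every new term is a product with \<open>d\<close> as first or last factor, whose
      coefficients up to \<open>Suc n\<close> see only the constant term of the other factor. For \<open>s * q\<close> and
      \<open>q * (s + d)\<close> that term is \<open>0\<close>.\<close>
    have "F (s + d) = F s + (a * d - d * b) - (s * q * d + d * (q * (s + d)))"
      unfolding F_def by (simp add: algebra_simps)
    then have "F (s + d) $ k = F s $ k + (if k = Suc n then a $ 0 * y - y * b $ 0 else 0)"
      if "k \<le> Suc n" for k
      using that s by (simp add: left right sol_def d_nth)
    then have "F (s + d) $ k = 0" if "k \<le> Suc n" for k
      using that s y unfolding sol_def by (cases "k = Suc n") auto
    then have "sol (Suc n) (s + d)" using s by (simp add: sol_def d_nth)
    moreover have "\<forall>k\<le>n. (s + d) $ k = s $ k" by (simp add: d_nth)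
    ultimately show ?thesis by blast
  qed
  have "sol 0 0" unfolding sol_def F_def using p by simp
  then have "\<exists>S. \<forall>n. sol n (S n) \<and> (\<forall>k\<le>n. S (Suc n) $ k = S n $ k)"
    using step by (intro dependent_nat_choice) blast+
  then obtain S where S: "\<And>n. sol n (S n)" "\<And>n k. k \<le> n \<Longrightarrow> S (Suc n) $ k = S n $ k"
    by blast
  have S_nth: "S n $ k = S k $ k" if "k \<le> n" for n k
    using that by (induction n rule: dec_induct) (simp_all add: S(2))
  define s where "s = Abs_fps (\<lambda>n. S n $ n)"
  have "F s $ n = 0" for n
  proof -
    have "s $ k = S n $ k" if "k \<le> n" for k using S_nth[OF that] by (simp add: s_def)
    then have "F s $ n = F (S n) $ n" by (intro causal) blast
    then show ?thesis using S(1)[of n] by (simp add: sol_def)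
  qed
  then have "F s = 0" by (simp add: fps_eq_iff)
  moreover have "s $ 0 = 0" using S(1)[of 0] by (simp add: s_def sol_def)
  ultimately show ?thesis unfolding F_def by (intro exI[of _ s]) (simp add: diff_eq_eq add.commute)
qed

text \<open>The column \<open>(1,t)\<close> spans a \<open>B\<close>-invariant submodule, with eigenvalue \<open>f + p * t\<close>, exactly
  when \<open>q + g * t = t * (f + p * t)\<close>; likewise \<open>(s,1)\<close> with eigenvalue \<open>g + q * s\<close> exactly when
  \<open>f * s + p = s * (g + q * s)\<close>. These are the two Riccati equations. As \<open>s\<close> and \<open>t\<close> have no constant
  term, the two columns form an invertible matrix.\<close>

lemma fps_mat2_diagonalisable:
  fixes B :: "'a::ring_1 fps mat2"
  assumes B: "const_term_mat2 B = diag2 a b"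
    and surj: "surj (\<lambda>s. a * s - s * b)" "surj (\<lambda>s. b * s - s * a)"
  shows "\<exists>S f g. two_sided_unit S \<and> B * S = S * diag2 f g"
proof -
  obtain f p q g where Beq: "B = Mat2 f p q g" by (cases B)
  with B have 0: "f $ 0 = a" "p $ 0 = 0" "q $ 0 = 0" "g $ 0 = b" by simp_all
  obtain s where s: "s $ 0 = 0" "f * s - s * g = - p + s * q * s"
    using fps_riccati_solution[of f g "- p" q] surj 0 by auto
  obtain t where t: "t $ 0 = 0" "g * t - t * f = - q + t * p * t"
    using fps_riccati_solution[of g f "- q" p] surj 0 by auto
  have "B * Mat2 1 s t 1 = Mat2 1 s t 1 * diag2 (f + p * t) (g + q * s)"
    unfolding Beq using s(2) t(2) by (simp add: algebra_simps)
  moreover have "const_term_mat2 (Mat2 1 s t 1) = 1" using s(1) t(1) by (simp add: one_mat2_def)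
  then have "two_sided_unit (Mat2 1 s t 1)" by (rule two_sided_unit_if_const_term_1)
  ultimately show ?thesis by blast
qed

text \<open>Each diagonal entry \<open>h\<close> may be treated on its own: its constant term lies in a local ring, so
  \<open>h\<close> or \<open>h - 1\<close> is a unit.\<close>

lemma very_clean_elt_diag2_fps:
  assumes loc: "local_ring TYPE('a::ring_1)"
  shows "very_clean_elt (diag2 f g :: 'a fps mat2)"
proof -
  have *: "\<exists>e. e * e = e \<and> h * e = e * h \<and> two_sided_unit (h - e)" for h :: "'a fps"
  proof (cases "two_sided_unit (h $ 0)")
    case True
    then show ?thesis by (intro exI[of _ 0]) (simp add: two_sided_unit_fps)
  next
    case False
    then have "two_sided_unit ((h - 1) $ 0)"
      using local_ring_unit_or[OF loc, of "h $ 0"] by simp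
    then show ?thesis by (intro exI[of _ 1]) (simp add: two_sided_unit_fps del: fps_sub_nth)
  qed
  obtain e where e: "e * e = e" "f * e = e * f" "two_sided_unit (f - e)" using * by blast
  obtain e' where e': "e' * e' = e'" "g * e' = e' * g" "two_sided_unit (g - e')" using * by blast
  show ?thesis
    unfolding very_clean_elt_def
    by (rule exI[of _ "diag2 e e'"]) (use e e' in \<open>simp add: two_sided_unit_diag2\<close>)
qed

section \<open>Lifting very clean matrices\<close>

lemma weakly_bleached_surj:
  assumes loc: "local_ring TYPE('a::ring_1)" and wb: "weakly_bleached TYPE('a)"
    and "\<not> two_sided_unit (a::'a)" "\<not> two_sided_unit (b - 1)"
  shows "surj (\<lambda>s. a * s - s * b)" "surj (\<lambda>s. b * s - s * a)"
proof -
  have a: "a \<in> jacobson_radical" and "b - 1 \<in> jacobson_radical"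
    using assms(3,4) local_ring_unit_iff[OF loc] by blast+
  then have "b \<in> (+) 1 ` jacobson_radical" by (intro image_eqI[of _ _ "b - 1"]) simp_all
  with a show "surj (\<lambda>s. a * s - s * b)" "surj (\<lambda>s. b * s - s * a)"
    using wb unfolding weakly_bleached_def by blast+
qed

text \<open>The proof does not lift the given idempotent \<open>E\<close>. Unless \<open>0\<close> or \<open>1\<close> serves for \<open>A\<close>, what \<open>E\<close>
  provides is a diagonal form of the constant term; this form lifts to \<open>A\<close>, and a new idempotent is
  read off from it.\<close>

lemma very_clean_elt_lift:
  fixes A :: "'a::ring_1 fps mat2"
  assumes loc: "local_ring TYPE('a)" and wb: "weakly_bleached TYPE('a)"
    and vc: "very_clean_elt (const_term_mat2 A)"
  shows "very_clean_elt A"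
proof -
  let ?A0 = "const_term_mat2 A"
  obtain E where E: "E * E = E" "?A0 * E = E * ?A0"
    "two_sided_unit (?A0 - E) \<or> two_sided_unit (?A0 + E)"
    using vc unfolding very_clean_elt_def by blast
  show ?thesis
  proof (cases "two_sided_unit A \<or> two_sided_unit (A - 1) \<or> two_sided_unit (A + 1)")
    case True
    then show ?thesis
      using very_clean_elt_if_unit very_clean_elt_if_unit_minus_1 very_clean_elt_if_unit_plus_1
      by blast
  next
    case False
    then have nu: "\<not> two_sided_unit ?A0" "\<not> two_sided_unit (?A0 - 1)" "\<not> two_sided_unit (?A0 + 1)"
      using two_sided_unit_fps_mat2[of A] two_sided_unit_fps_mat2[of "A - 1"]
        two_sided_unit_fps_mat2[of "A + 1"] by (auto simp: const_term_mat2_hom)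
    then have "E \<noteq> 0" "E \<noteq> 1" using E(3) by auto
    then obtain P a b where P: "two_sided_unit P" "?A0 * P = P * diag2 a b"
      using commuting_idempotent_diagonalises[OF loc E(1) _ _ E(2)] by blast
    have "(?A0 - 1) * P = P * diag2 (a - 1) (b - 1)"
    proof -
      have "(?A0 - 1) * P = P * (diag2 a b - 1)" using P(2) by (simp add: algebra_simps)
      then show ?thesis by (simp add: one_mat2_def)
    qed
    then have "\<not> two_sided_unit (diag2 a b)" "\<not> two_sided_unit (diag2 (a - 1) (b - 1))"
      using nu P two_sided_unit_similar by blast+
    then have "\<not> two_sided_unit a \<or> \<not> two_sided_unit b"
      "\<not> two_sided_unit (a - 1) \<or> \<not> two_sided_unit (b - 1)"
      using two_sided_unit_diag2 by blast+
    \<comment> \<open>No element is a non-unit together with its difference from \<open>1\<close>, so the two non-units sit in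
      different diagonal positions.\<close>
    then have "\<not> two_sided_unit a \<and> \<not> two_sided_unit (b - 1) \<or>
        \<not> two_sided_unit b \<and> \<not> two_sided_unit (a - 1)"
      using local_ring_unit_or[OF loc, of a] local_ring_unit_or[OF loc, of b] by blast
    then have surj: "surj (\<lambda>s. a * s - s * b)" "surj (\<lambda>s. b * s - s * a)"
      using weakly_bleached_surj[OF loc wb] by blast+
    obtain Q where Q: "P * Q = 1" "Q * P = 1" using P(1) by (rule two_sided_unitE)
    let ?P = "map_mat2 fps_const P" and ?Q = "map_mat2 fps_const Q"
    have PQ: "?P * ?Q = 1" "?Q * ?P = 1" using Q by (simp_all flip: fps_const_mat2_hom)
    have "const_term_mat2 (?Q * A * ?P) = Q * (?A0 * P)"
      by (simp add: const_term_mat2_hom mult.assoc)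
    also have "\<dots> = diag2 a b" unfolding P(2) using Q by (simp flip: mult.assoc)
    finally obtain S f g where S: "two_sided_unit S" "?Q * A * ?P * S = S * diag2 f g"
      using fps_mat2_diagonalisable surj by blast
    have "A * (?P * S) = ?P * (?Q * A * ?P * S)" using PQ by (simp flip: mult.assoc)
    also have "\<dots> = ?P * S * diag2 f g" unfolding S(2) by (simp only: mult.assoc)
    finally have "A * (?P * S) = ?P * S * diag2 f g" .
    moreover have "two_sided_unit (?P * S)"
      using two_sided_unit_mult[OF two_sided_unitI[OF PQ] S(1)] .
    ultimately show ?thesis using very_clean_elt_similar very_clean_elt_diag2_fps[OF loc] by blast
  qed
qed

lemma very_clean_elt_const_term:
  assumes "very_clean_elt A"
  shows "very_clean_elt (const_term_mat2 A)"
proof -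
  obtain E where E: "E * E = E" "A * E = E * A" "two_sided_unit (A - E) \<or> two_sided_unit (A + E)"
    using assms unfolding very_clean_elt_def by blast
  have unit: "two_sided_unit (const_term_mat2 X)" if "two_sided_unit X" for X :: "'a fps mat2"
    using that by (metis two_sided_unit_def const_term_mat2_hom(1,4))
  show ?thesis
    unfolding very_clean_elt_def
  proof (intro exI[of _ "const_term_mat2 E"] conjI)
    show "const_term_mat2 E * const_term_mat2 E = const_term_mat2 E"
      "const_term_mat2 A * const_term_mat2 E = const_term_mat2 E * const_term_mat2 A"
      using E(1,2) by (metis const_term_mat2_hom(1))+
    show "two_sided_unit (const_term_mat2 A - const_term_mat2 E) \<or>
        two_sided_unit (const_term_mat2 A + const_term_mat2 E)"
      using E(3) unit[of "A - E"] unit[of "A + E"] by (auto simp: const_term_mat2_hom)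
  qed
qed

section \<open>Matrices of dimension two as quadruples\<close>

definition mat2_of_mat :: "'a mat \<Rightarrow> 'a mat2" where
  "mat2_of_mat A = Mat2 (A $$ (0,0)) (A $$ (0,1)) (A $$ (1,0)) (A $$ (1,1))"

definition mat_of_mat2 :: "'a mat2 \<Rightarrow> 'a mat" where
  "mat_of_mat2 M = (case M of Mat2 a b c d \<Rightarrow>
     mat 2 2 (\<lambda>(i, j). if i = 0 then if j = 0 then a else b else if j = 0 then c else d))"

lemma mat_of_mat2_carrier [simp]: "mat_of_mat2 M \<in> carrier_mat 2 2"
  by (cases M) (simp add: mat_of_mat2_def)

lemma mat2_of_mat_of_mat2 [simp]: "mat2_of_mat (mat_of_mat2 M) = M"
  by (cases M) (simp add: mat_of_mat2_def mat2_of_mat_def)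

lemma mat2_of_mat_eq_iff:
  assumes "A \<in> carrier_mat 2 2" "B \<in> carrier_mat 2 2"
  shows "mat2_of_mat A = mat2_of_mat B \<longleftrightarrow> A = B"
  using assms by (auto simp: mat2_of_mat_def less_2_cases_iff intro!: eq_matI)

lemma mat2_of_mat_hom:
  fixes A B :: "'a::ring_1 mat"
  assumes "A \<in> carrier_mat 2 2" "B \<in> carrier_mat 2 2"
  shows "mat2_of_mat (A * B) = mat2_of_mat A * mat2_of_mat B"
    and "mat2_of_mat (A + B) = mat2_of_mat A + mat2_of_mat B"
    and "mat2_of_mat (A - B) = mat2_of_mat A - mat2_of_mat B"
    and "mat2_of_mat (1\<^sub>m 2 :: 'a mat) = 1"
  using assms by (simp_all add: mat2_of_mat_def scalar_prod_def numeral_2_eq_2 one_mat2_def)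

lemma Units_M2_iff:
  assumes A: "A \<in> carrier_mat 2 2"
  shows "A \<in> Units (M2 TYPE('a::ring_1)) \<longleftrightarrow> two_sided_unit (mat2_of_mat A)"
proof
  assume "A \<in> Units (M2 TYPE('a))"
  then obtain B where "B \<in> carrier_mat 2 2" "B * A = 1\<^sub>m 2" "A * B = 1\<^sub>m 2"
    unfolding Units_def ring_mat_simps by blast
  then show "two_sided_unit (mat2_of_mat A)"
    using A by (intro two_sided_unitI[of _ "mat2_of_mat B"]) (simp_all flip: mat2_of_mat_hom)
next
  assume "two_sided_unit (mat2_of_mat A)"
  then obtain Y where Y: "mat2_of_mat A * Y = 1" "Y * mat2_of_mat A = 1" by (rule two_sided_unitE)
  have "A * mat_of_mat2 Y = 1\<^sub>m 2" "mat_of_mat2 Y * A = 1\<^sub>m 2"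
    using A Y by (subst mat2_of_mat_eq_iff[symmetric];
        simp add: mat2_of_mat_hom mult_carrier_mat[of _ 2 2 _ 2])+
  then show "A \<in> Units (M2 TYPE('a))"
    unfolding Units_def ring_mat_simps using A mat_of_mat2_carrier by blast
qed

lemma very_clean_M2_iff:
  assumes A: "A \<in> carrier_mat 2 2"
  shows "very_clean (M2 TYPE('a::ring_1)) A \<longleftrightarrow> very_clean_elt (mat2_of_mat A)"
proof -
  have eq: "E * E = E \<and> A * E = E * A \<and>
        (A \<ominus>\<^bsub>M2 TYPE('a)\<^esub> E \<in> Units (M2 TYPE('a)) \<or> A + E \<in> Units (M2 TYPE('a))) \<longleftrightarrow>
      mat2_of_mat E * mat2_of_mat E = mat2_of_mat E \<and>
        mat2_of_mat A * mat2_of_mat E = mat2_of_mat E * mat2_of_mat A \<and>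
        (two_sided_unit (mat2_of_mat A - mat2_of_mat E) \<or>
         two_sided_unit (mat2_of_mat A + mat2_of_mat E))"
    if E: "E \<in> carrier_mat 2 2" for E
    using A E by (simp add: minus_ring_mat minus_carrier_mat Units_M2_iff mult_carrier_mat[of _ 2 2 _ 2]
        flip: mat2_of_mat_hom mat2_of_mat_eq_iff)
  show ?thesis
    unfolding very_clean_def very_clean_elt_def ring_mat_simps
    using eq mat_of_mat2_carrier mat2_of_mat_of_mat2 by metis
qed

theorem theorem4p2:
  fixes A :: "'a::ring_1 fps mat"
  assumes "local_ring TYPE('a)"
    and "weakly_bleached TYPE('a)"
    and "A \<in> carrier (M2 TYPE('a fps))"
  shows "very_clean (M2 TYPE('a fps)) A \<longleftrightarrow>
         very_clean (M2 TYPE('a)) (map_mat (\<lambda>f. fps_nth f 0) A)"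
proof -
  let ?A0 = "map_mat (\<lambda>f. fps_nth f 0) A"
  have A: "A \<in> carrier_mat 2 2" "?A0 \<in> carrier_mat 2 2"
    using assms(3) by (simp_all add: ring_mat_simps)
  have "mat2_of_mat ?A0 = const_term_mat2 (mat2_of_mat A)"
    using A by (simp add: mat2_of_mat_def)
  then show ?thesis
    using A very_clean_M2_iff very_clean_elt_lift[OF assms(1,2)] very_clean_elt_const_term by metis
qed

end
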